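(* Let $X$ be a finite set of cardinality $n$, let $N=\binom{n}{2}$, and let $\ast\in\mathcal{M}(X)$ be a binary operation with $crank(T_\ast)=c$ and $arank(T_\ast)=a$. Then the cardinality of the $\mathcal{R}$-class of $\ast$ in $\mathcal{M}(X)$ is precisely $$2^a\,\frac{n!}{(n-c)!}\,\frac{N!}{(N-a)!}.$$
   Context: $\mathcal{M}(X)=X^{X\times X}$ is the set of all binary operations on $X$, a monoid under $\triangleright$ defined by $a(\circ\triangleright\ast)b=(a\circ b)\ast(b\circ a)$ for all $a,b\in X$, with identity $a\circ_{lz}b=a$. The right Green's relation $\mathcal{R}$: $\ast\,\mathcal{R}\,\star$ iff $\{\ast\triangleright\circ:\circ\in\mathcal{M}(X)\}=\{\star\triangleright\circ:\circ\in\mathcal{M}(X)\}$. The pairmorph transformation of $\ast$ is $T_\ast:X\times X\to X\times X$, $T_\ast(a,b)=(a\ast b,b\ast a)$. Let $\Delta(X)=\{(x,x):x\in X\}$ and $im(T_\ast)=T_\ast(X\times X)$. Fix a tournament $\omega$ on $X$, i.e. a set $\omega\subseteq X\times X\setminus\Delta(X)$ containing exactly one of $(a,b),(b,a)$ for every pair of distinct $a,b\in X$. Let $acdom(T_\ast)=\{(a,b)\in X\times X:T_\ast(a,b)\notin\Delta(X)\}$, and let $accok_\ast:acdom(T_\ast)\cap\omega\to\omega$ be given by $accok_\ast(a,b)=T_\ast(a,b)$ if $T_\ast(a,b)\in\omega$, and $accok_\ast(a,b)=T_\ast(b,a)$ otherwise. Define $crank(T_\ast)=|im(T_\ast)\cap\Delta(X)|$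 and $arank(T_\ast)=|im(accok_\ast)|$. *)

theory Defs
  imports Complex_Main "HOL-Algebra.Group"
begin

text \<open>
  A binary operation on the set \<open>X\<close> is an element of \<open>X\<close> to the power \<open>X \<times> X\<close>: a function on pairs,
  extensional outside \<open>X \<times> X\<close>, so that distinct functions are distinct operations on \<open>X\<close> and
  cardinalities of sets of operations are the intended ones. The value \<open>f (a, b)\<close> stands for
  the infix product of \<open>a\<close> and \<open>b\<close>.
\<close>

definition binops :: "'a set \<Rightarrow> ('a \<times> 'a \<Rightarrow> 'a) set" where
  "binops X = (X \<times> X) \<rightarrow>\<^sub>E X"

definition binop_monoid :: "'a set \<Rightarrow> ('a \<times> 'a \<Rightarrow> 'a) monoid" where
  "binop_monoid X =
     \<lparr> carrier = binops X,
       mult = (\<lambda>f g. \<lambda>(a, b)\<in>X \<times> X. g (f (a, b), f (b, a))),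
       one = (\<lambda>(a, b)\<in>X \<times> X. a) \<rparr>"

lemma monoid_binop_monoid: "monoid (binop_monoid X)"
proof (rule monoidI)
  fix f assume f: "f \<in> carrier (binop_monoid X)"
  then show "\<one>\<^bsub>binop_monoid X\<^esub> \<otimes>\<^bsub>binop_monoid X\<^esub> f = f"
    and "f \<otimes>\<^bsub>binop_monoid X\<^esub> \<one>\<^bsub>binop_monoid X\<^esub> = f"
    by (fastforce simp: binop_monoid_def binops_def PiE_iff extensional_def restrict_def fun_eq_iff)+
qed (auto simp: binop_monoid_def binops_def PiE_iff extensional_def restrict_def fun_eq_iff)

definition green_R :: "('m, 'b) monoid_scheme \<Rightarrow> 'm \<Rightarrow> 'm \<Rightarrow> bool" where
  "green_R M x y \<longleftrightarrow>
     {x \<otimes>\<^bsub>M\<^esub> z |z. z \<in> carrier M} = {y \<otimes>\<^bsub>M\<^esub> z |z. z \<in> carrier M}"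

definition R_class :: "('m, 'b) monoid_scheme \<Rightarrow> 'm \<Rightarrow> 'm set" where
  "R_class M x = {y \<in> carrier M. green_R M x y}"

definition pairmorph :: "'a set \<Rightarrow> ('a \<times> 'a \<Rightarrow> 'a) \<Rightarrow> 'a \<times> 'a \<Rightarrow> 'a \<times> 'a" where
  "pairmorph X f = (\<lambda>(a, b)\<in>X \<times> X. (f (a, b), f (b, a)))"

definition tournament :: "'a set \<Rightarrow> ('a \<times> 'a) set \<Rightarrow> bool" where
  "tournament X \<omega> \<longleftrightarrow>
     \<omega> \<subseteq> X \<times> X - Id_on X \<and>
     (\<forall>a\<in>X. \<forall>b\<in>X. a \<noteq> b \<longrightarrow> ((a, b) \<in> \<omega> \<longleftrightarrow> (b, a) \<notin> \<omega>))"

definition acdom :: "'a set \<Rightarrow> ('a \<times> 'a \<Rightarrow> 'a) \<Rightarrow> ('a \<times> 'a) set" where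
  "acdom X f = {p \<in> X \<times> X. pairmorph X f p \<notin> Id_on X}"

definition accok ::
  "'a set \<Rightarrow> ('a \<times> 'a) set \<Rightarrow> ('a \<times> 'a \<Rightarrow> 'a) \<Rightarrow> 'a \<times> 'a \<Rightarrow> 'a \<times> 'a" where
  "accok X \<omega> f =
     (\<lambda>(a, b)\<in>acdom X f \<inter> \<omega>.
        if pairmorph X f (a, b) \<in> \<omega> then pairmorph X f (a, b) else pairmorph X f (b, a))"

definition crank :: "'a set \<Rightarrow> ('a \<times> 'a \<Rightarrow> 'a) \<Rightarrow> nat" where
  "crank X f = card (pairmorph X f ` (X \<times> X) \<inter> Id_on X)"

definition arank :: "'a set \<Rightarrow> ('a \<times> 'a) set \<Rightarrow> ('a \<times> 'a \<Rightarrow> 'a) \<Rightarrow> nat" where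
  "arank X \<omega> f = card (accok X \<omega> f ` (acdom X f \<inter> \<omega>))"

end

theory Submission imports Defs begin

text \<open>
  The map \<open>f \<mapsto> T\<^sub>f\<close> turns the monoid operation into composition, \<open>T\<^bsub>f \<triangleright> g\<^esub> = T\<^sub>g \<circ> T\<^sub>f\<close>, and its
  image consists of the self-maps of \<open>X \<times> X\<close> that commute with the swap \<open>(a, b) \<mapsto> (b, a)\<close>. Hence \<open>g\<close> is
  \<open>\<R>\<close>-related to \<open>f\<close> iff \<open>T\<^sub>f\<close> and \<open>T\<^sub>g\<close> have the same kernel, that is, iff
  \<open>T\<^sub>g = e \<circ> T\<^sub>f\<close> for a swap-equivariant injection \<open>e\<close> of the image of \<open>T\<^sub>f\<close> into \<open>X \<times> X\<close>.
  Such an \<open>e\<close> preserves and reflects fixed points of the swap. So it amounts to an injection of the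
  \<open>c\<close> diagonal points into \<open>X\<close>, an injection of the \<open>a\<close> two-element swap orbits
  (represented by \<open>\<omega>\<close>) into the \<open>N\<close> orbits of \<open>X \<times> X\<close>, and a choice of orientation for each of the \<open>a\<close> orbits.
\<close>

section \<open>Counting injections and the edges of a tournament\<close>

lemma card_injections:
  assumes "finite A" "finite B" "card A \<le> card B"
  shows "real (card {h \<in> A \<rightarrow>\<^sub>E B. inj_on h A}) = fact (card B) / fact (card B - card A)"
proof -
  \<comment> \<open>The falling factorial is completed to \<open>m!\<close>. The bound matters: for
    \<open>k > m\<close> the product is 0, while truncated subtraction turns
    \<open>fact (m - k)\<close> into 1.\<close>
  have "(\<Prod>i = 0..<k. real (m - i)) * fact (m - k) = fact m" if "k \<le> m" for k m
    using that
  proof (induction k)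
    case (Suc k)
    then have "fact (m - k) = real (m - k) * fact (m - Suc k)"
      by (subst fact_reduce) auto
    then show ?case
      using Suc by (simp add: mult.assoc)
  qed simp
  from this[OF assms(3)] show ?thesis
    \<comment> \<open>Injectivity is demanded on the whole domain, so the factor for unconstrained
      arguments is \<open>card B ^ 0\<close>.\<close>
    unfolding card_inj_on_subset_funcset[OF assms(1,2) subset_refl]
    by (simp only: nonzero_eq_divide_eq fact_nonzero of_nat_mult of_nat_prod
        diff_self_eq_0 power_0 mult_1_left of_nat_1 not_False_eq_True)
qed

lemma tournament_swap_iff:
  assumes "tournament X \<omega>" "q \<in> X \<times> X" "fst q \<noteq> snd q"
  shows "prod.swap q \<in> \<omega> \<longleftrightarrow> q \<notin> \<omega>"
proof -
  obtain a b where q: "q = (a, b)" "a \<in> X" "b \<in> X" "a \<noteq> b"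
    using assms(2,3) by (cases q) auto
  then have "(a, b) \<in> \<omega> \<longleftrightarrow> (b, a) \<notin> \<omega>"
    using assms(1) unfolding tournament_def by blast
  then show ?thesis
    by (simp add: q(1))
qed

lemma tournament_offdiag:
  assumes "tournament X \<omega>" "q \<in> \<omega>"
  shows "q \<in> X \<times> X" "fst q \<noteq> snd q"
proof -
  have "q \<in> X \<times> X - Id_on X"
    using assms unfolding tournament_def by blast
  then show "q \<in> X \<times> X" "fst q \<noteq> snd q"
    by (cases q; auto)+
qed

text \<open>Forgetting the orientation matches \<open>\<omega>\<close> with the two-element subsets
  of \<open>X\<close>, since exactly one of the two orderings of such a subset lies in
  \<open>\<omega>\<close>.\<close>

lemma card_tournament:
  assumes "finite X" "tournament X \<omega>"
  shows "card \<omega> = card X choose 2"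
proof -
  have "bij_betw (\<lambda>(a, b). {a, b}) \<omega> {B. B \<subseteq> X \<and> card B = 2}"
  proof (rule bij_betw_imageI)
    show "inj_on (\<lambda>(a, b). {a, b}) \<omega>"
    proof (rule inj_onI)
      fix p q assume pq: "p \<in> \<omega>" "q \<in> \<omega>" "(\<lambda>(a, b). {a, b}) p = (\<lambda>(a, b). {a, b}) q"
      then have "q = p \<or> q = prod.swap p"
        by (cases p; cases q) (auto simp: doubleton_eq_iff)
      then show "p = q"
        using tournament_swap_iff[OF assms(2)] tournament_offdiag[OF assms(2) pq(1)] pq(1,2) by blast
    qed
    show "(\<lambda>(a, b). {a, b}) ` \<omega> = {B. B \<subseteq> X \<and> card B = 2}"
    proof (intro equalityI subsetI)
      fix B assume "B \<in> (\<lambda>(a, b). {a, b}) ` \<omega>"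
      then show "B \<in> {B. B \<subseteq> X \<and> card B = 2}"
        using tournament_offdiag[OF assms(2)] by fastforce
    next
      fix B assume "B \<in> {B. B \<subseteq> X \<and> card B = 2}"
      then obtain a b where "B = {a, b}" "a \<noteq> b" "a \<in> X" "b \<in> X"
        by (auto simp: card_2_iff)
      moreover from this have "(a, b) \<in> \<omega> \<or> (b, a) \<in> \<omega>"
        using assms(2) unfolding tournament_def by blast
      ultimately show "B \<in> (\<lambda>(a, b). {a, b}) ` \<omega>"
        by (force simp: image_iff insert_commute)
    qed
  qed
  then show ?thesis
    using n_subsets[OF assms(1), of 2] by (simp add: bij_betw_same_card)
qed

section \<open>Swap-equivariant injections and their number\<close>

definition equivariant_injections :: "('a \<times> 'a) set \<Rightarrow> 'a set \<Rightarrow> ('a \<times> 'a \<Rightarrow> 'a \<times> 'a) set" where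
  "equivariant_injections I X =
     {e \<in> I \<rightarrow>\<^sub>E X \<times> X. inj_on e I \<and> (\<forall>q\<in>I. e (prod.swap q) = prod.swap (e q))}"

text \<open>The diagonal is the fixed-point set of the swap: equivariance carries fixed points
  forward, injectivity carries them back.\<close>

lemma equivariant_injection_diag_iff:
  assumes "e \<in> equivariant_injections I X" "prod.swap ` I \<subseteq> I" "q \<in> I"
  shows "fst (e q) = snd (e q) \<longleftrightarrow> fst q = snd q"
proof -
  have diag: "fst p = snd p \<longleftrightarrow> prod.swap p = p" for p :: "'a \<times> 'a"
    by (cases p) auto
  have "e (prod.swap q) = prod.swap (e q)" "prod.swap q \<in> I" "inj_on e I"
    using assms by (auto simp: equivariant_injections_def)
  then show ?thesis
    using assms(3) unfolding diag by (metis inj_onD)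
qed

text \<open>Here \<open>u\<close> acts on the diagonal, \<open>w\<close> on the representatives in
  \<open>\<omega>\<close>, and \<open>S\<close> marks the representatives whose image is reversed.
  The last branch is forced by equivariance: it is the swap of the value at
  \<open>prod.swap q\<close>.\<close>

definition equivariant_extension ::
  "('a \<times> 'a) set \<Rightarrow> ('a \<Rightarrow> 'a) \<Rightarrow> ('a \<times> 'a \<Rightarrow> 'a \<times> 'a) \<Rightarrow> ('a \<times> 'a) set \<Rightarrow> 'a \<times> 'a \<Rightarrow> 'a \<times> 'a" where
  "equivariant_extension \<omega> u w S q =
     (if fst q = snd q then (u (fst q), u (fst q))
      else if q \<in> \<omega> then (if q \<in> S then prod.swap (w q) else w q)
      else (if prod.swap q \<in> S then w (prod.swap q) else prod.swap (w (prod.swap q))))"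

lemma swap_equivariant_extension:
  assumes "tournament X \<omega>" "q \<in> X \<times> X"
  shows "equivariant_extension \<omega> u w S (prod.swap q) = prod.swap (equivariant_extension \<omega> u w S q)"
  using tournament_swap_iff[OF assms] by (auto simp: equivariant_extension_def)

text \<open>The three components can be chosen independently, which is the source of the three
  factors of the count. Because \<open>I\<close> is closed under the swap,
  \<open>I \<inter> \<omega>\<close> contains exactly one point of each off-diagonal orbit in
  \<open>I\<close>.\<close>

lemma bij_betw_equivariant_extension:
  assumes \<omega>: "tournament X \<omega>" and I: "I \<subseteq> X \<times> X" "prod.swap ` I \<subseteq> I"
  defines "D \<equiv> {x. (x, x) \<in> I}"
  shows "bij_betw (\<lambda>(u, w, S). restrict (equivariant_extension \<omega> u w S) I)
    ({u \<in> D \<rightarrow>\<^sub>E X. inj_on u D} \<times> {w \<in> I \<inter> \<omega> \<rightarrow>\<^sub>E \<omega>. inj_on w (I \<inter> \<omega>)} \<times> Pow (I \<inter> \<omega>))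
    (equivariant_injections I X)"
proof -
  let ?A = "I \<inter> \<omega>"
  have swapI: "prod.swap q \<in> I" if "q \<in> I" for q
    using I(2) that by blast
  have offdiag: "q \<in> ?A \<or> prod.swap q \<in> ?A" if "q \<in> I" "fst q \<noteq> snd q" for q
    using tournament_swap_iff[OF \<omega>, of q] I(1) that swapI by auto
  have swap\<omega>: "prod.swap q \<notin> \<omega>" if "q \<in> \<omega>" for q
    using tournament_swap_iff[OF \<omega>] tournament_offdiag[OF \<omega> that] that by blast
  \<comment> \<open>The inverse map: on a representative, \<open>w\<close> records whichever of
    \<open>e q\<close> and its swap lies in \<open>\<omega>\<close>, and \<open>S\<close> records
    where the swap was taken.\<close>
  define \<Phi> where "\<Phi> = (\<lambda>e :: 'a \<times> 'a \<Rightarrow> 'a \<times> 'a.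
    (\<lambda>x\<in>D. fst (e (x, x)), \<lambda>q\<in>?A. if e q \<in> \<omega> then e q else prod.swap (e q), {q \<in> ?A. e q \<notin> \<omega>}))"
  show ?thesis
  proof (rule bij_betw_byWitness[where f' = \<Phi>]; (rule ballI | rule image_subsetI); clarify?)
    fix u w S
    assume u: "u \<in> D \<rightarrow>\<^sub>E X" "inj_on u D" and w: "w \<in> ?A \<rightarrow>\<^sub>E \<omega>" "inj_on w ?A" and S: "S \<subseteq> ?A"
    let ?e = "equivariant_extension \<omega> u w S"
    have w\<omega>: "w q \<in> \<omega>" if "q \<in> ?A" for q
      using w that by blast
    have e_diag: "?e (x, x) = (u x, u x)" for x
      by (simp add: equivariant_extension_def)
    have e_A: "?e q = (if q \<in> S then prod.swap (w q) else w q)" if "q \<in> ?A" for q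
      using that tournament_offdiag[OF \<omega>, of q] by (auto simp: equivariant_extension_def)
    have e_swap: "?e (prod.swap q) = prod.swap (?e q)" if "q \<in> I" for q
      using swap_equivariant_extension[OF \<omega>] I that by blast
    show "\<Phi> (restrict ?e I) = (u, w, S)"
    proof -
      have "(\<lambda>x\<in>D. fst (restrict ?e I (x, x))) = u"
        using u by (auto simp: e_diag D_def fun_eq_iff PiE_iff extensional_def)
      moreover have "(\<lambda>q\<in>?A. if restrict ?e I q \<in> \<omega> then restrict ?e I q else prod.swap (restrict ?e I q)) = w"
      proof
        fix q
        show "(\<lambda>q\<in>?A. if restrict ?e I q \<in> \<omega> then restrict ?e I q else prod.swap (restrict ?e I q)) q = w q"
          using w swap\<omega> w\<omega>[of q] e_A[of q] PiE_arb[OF w(1), of q]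
          by (cases "q \<in> ?A") auto
      qed
      moreover have "{q \<in> ?A. restrict ?e I q \<notin> \<omega>} = S"
      proof -
        have "restrict ?e I q \<notin> \<omega> \<longleftrightarrow> q \<in> S" if "q \<in> ?A" for q
          using e_A[OF that] w\<omega>[OF that] swap\<omega>[OF w\<omega>[OF that]] that by auto
        then show ?thesis
          using S by blast
      qed
      ultimately show ?thesis
        by (simp add: \<Phi>_def)
    qed
    have e_XX: "?e q \<in> X \<times> X" if "q \<in> I" for q
    proof (cases "fst q = snd q")
      case True
      then show ?thesis
        using that u e_diag[of "fst q"] by (cases q) (auto simp: D_def)
    next
      case False
      have *: "?e p \<in> X \<times> X" if "p \<in> ?A" for p
        using e_A[OF that] tournament_offdiag(1)[OF \<omega> w\<omega>[OF that]] by auto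
      from offdiag[OF that False] show ?thesis
      proof
        assume "prod.swap q \<in> ?A"
        from *[OF this] show ?thesis
          using e_swap[OF that] by (simp add: mem_Times_iff)
      qed (rule *)
    qed
    \<comment> \<open>Off the diagonal the value is an element of \<open>\<omega>\<close> or the
      swap of one, hence never diagonal. So diagonal and off-diagonal points cannot collide.\<close>
    have e_fix: "fst q = snd q" if "q \<in> I" "fst (?e q) = snd (?e q)" for q
    proof (rule ccontr)
      have *: "fst (?e p) \<noteq> snd (?e p)" if "p \<in> ?A" for p
        using e_A[OF that] tournament_offdiag(2)[OF \<omega> w\<omega>[OF that]] by auto
      assume "fst q \<noteq> snd q"
      then show False
        using offdiag[OF that(1)] * e_swap[OF that(1)] that(2) by fastforce
    qed
    \<comment> \<open>One argument is taken to be a representative. Equal values give equal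
      \<open>w\<close>-values, as \<open>\<omega>\<close> never contains both a pair and its swap.
      If only \<open>prod.swap q\<close> is a representative, this yields
      \<open>p = prod.swap q\<close>, so \<open>?e p\<close> equals its own swap, contradicting
      \<open>e_fix\<close>.\<close>
    have e_inj_A: "p = q" if "p \<in> ?A" "q \<in> I" "?e p = ?e q" for p q
    proof -
      have "fst q \<noteq> snd q"
        using that e_fix[of p] e_diag[of "fst q"] tournament_offdiag(2)[OF \<omega>, of p] by (cases q) auto
      from offdiag[OF that(2) this] show ?thesis
      proof
        assume q: "q \<in> ?A"
        then have "w p = w q"
          using that e_A swap\<omega> w\<omega> by (metis swap_swap)
        then show ?thesis
          using w(2) that q by (auto dest: inj_onD)
      next
        assume q: "prod.swap q \<in> ?A"
        then have eq: "?e p = prod.swap (?e (prod.swap q))"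
          using that e_swap by simp
        then have "w p = w (prod.swap q)"
          using that q e_A swap\<omega> w\<omega> by (metis swap_swap)
        then have "p = prod.swap q"
          using w(2) that q by (auto dest: inj_onD)
        then have "fst (?e p) = snd (?e p)"
          using eq by (metis fst_swap)
        then show ?thesis
          using e_fix[of p] that tournament_offdiag(2)[OF \<omega>, of p] by auto
      qed
    qed
    have "inj_on ?e I"
    proof (rule inj_onI)
      fix p q assume pq: "p \<in> I" "q \<in> I" "?e p = ?e q"
      show "p = q"
      proof (cases "fst p = snd p")
        case True
        then have "fst q = snd q"
          using pq e_fix[of q] e_diag[of "fst p"] by (cases p) auto
        then have "u (fst p) = u (fst q)" "fst p \<in> D" "fst q \<in> D"
          using True pq e_diag[of "fst p"] e_diag[of "fst q"] by (cases p; cases q; auto simp: D_def)+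
        then have "fst p = fst q"
          using inj_onD[OF u(2)] by blast
        then show ?thesis
          using True \<open>fst q = snd q\<close> by (simp add: prod_eq_iff)
      next
        case False
        from offdiag[OF pq(1) this] show ?thesis
        proof
          assume "prod.swap p \<in> ?A"
          then have "prod.swap p = prod.swap q"
            using e_inj_A[of "prod.swap p" "prod.swap q"] pq e_swap swapI by auto
          then show ?thesis by (metis swap_swap)
        qed (use e_inj_A pq in blast)
      qed
    qed
    then show "restrict ?e I \<in> equivariant_injections I X"
      using e_XX e_swap swapI by (auto simp: equivariant_injections_def)
  next
    fix e assume e: "e \<in> equivariant_injections I X"
    then have e_ext: "e \<in> I \<rightarrow>\<^sub>E X \<times> X" and e_inj: "inj_on e I"
      and e_swap: "\<And>q. q \<in> I \<Longrightarrow> e (prod.swap q) = prod.swap (e q)"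
      by (auto simp: equivariant_injections_def)
    note e_diag = equivariant_injection_diag_iff[OF e I(2)]
    \<comment> \<open>Since \<open>e q\<close> is again off-diagonal, exactly one of its two
      orientations lies in \<open>\<omega>\<close>, so the second component of
      \<open>\<Phi> e\<close> takes its values in \<open>\<omega>\<close>.\<close>
    have e_\<omega>: "prod.swap (e q) \<in> \<omega> \<longleftrightarrow> e q \<notin> \<omega>" if "q \<in> I" "fst q \<noteq> snd q" for q
      using tournament_swap_iff[OF \<omega>] e_diag that PiE_mem[OF e_ext] by blast
    show "(case \<Phi> e of (u, w, S) \<Rightarrow> restrict (equivariant_extension \<omega> u w S) I) = e"
    proof
      fix q
      show "(case \<Phi> e of (u, w, S) \<Rightarrow> restrict (equivariant_extension \<omega> u w S) I) q = e q"
      proof (cases "q \<in> I")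
        case True
        consider "fst q = snd q" | "q \<in> ?A" "fst q \<noteq> snd q"
          | "prod.swap q \<in> ?A" "q \<notin> \<omega>" "fst q \<noteq> snd q"
          using offdiag[OF True] swap\<omega> by fastforce
        then show ?thesis
        proof cases
          case 1
          then show ?thesis
            using True e_diag[OF True] by (cases q; cases "e q") (auto simp: \<Phi>_def equivariant_extension_def D_def)
        next
          case 2
          then show ?thesis
            using True by (auto simp: \<Phi>_def equivariant_extension_def)
        next
          case 3
          then show ?thesis
            using True e_swap[OF True] by (auto simp: \<Phi>_def equivariant_extension_def)
        qed
      next
        case False
        then show ?thesis
          using PiE_arb[OF e_ext] by (simp add: \<Phi>_def)
      qed
    qed
    have "inj_on (\<lambda>x\<in>D. fst (e (x, x))) D"
    proof (rule inj_onI)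
      fix x y assume xy: "x \<in> D" "y \<in> D" "(\<lambda>x\<in>D. fst (e (x, x))) x = (\<lambda>x\<in>D. fst (e (x, x))) y"
      then have "e (x, x) = e (y, y)"
        using e_diag[of "(x, x)"] e_diag[of "(y, y)"] by (auto simp: D_def intro: prod_eqI)
      then show "x = y"
        using inj_onD[OF e_inj, of "(x, x)" "(y, y)"] xy by (auto simp: D_def)
    qed
    moreover have "(\<lambda>x\<in>D. fst (e (x, x))) \<in> D \<rightarrow>\<^sub>E X"
      using PiE_mem[OF e_ext] by (fastforce simp: D_def mem_Times_iff)
    \<comment> \<open>Equal chosen orientations mean that \<open>e p\<close> is \<open>e q\<close>
      or its swap, so \<open>p\<close> is \<open>q\<close> or its swap; two representatives cannot
      be swaps of each other.\<close>
    moreover have "inj_on (\<lambda>q\<in>?A. if e q \<in> \<omega> then e q else prod.swap (e q)) ?A"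
    proof (rule inj_onI)
      fix p q assume pq: "p \<in> ?A" "q \<in> ?A" and "(\<lambda>q\<in>?A. if e q \<in> \<omega> then e q else prod.swap (e q)) p =
        (\<lambda>q\<in>?A. if e q \<in> \<omega> then e q else prod.swap (e q)) q"
      then have "e p = e q \<or> e p = prod.swap (e q)"
        by (auto split: if_splits) (metis swap_swap)+
      then have "e p = e q \<or> e p = e (prod.swap q)"
        using e_swap pq by auto
      then have "p = q \<or> p = prod.swap q"
        using inj_onD[OF e_inj] swapI pq by blast
      then show "p = q"
        using swap\<omega> pq by blast
    qed
    moreover have "(\<lambda>q\<in>?A. if e q \<in> \<omega> then e q else prod.swap (e q)) \<in> ?A \<rightarrow>\<^sub>E \<omega>"
      using e_\<omega> tournament_offdiag(2)[OF \<omega>] by auto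
    ultimately show "\<Phi> e \<in> {u \<in> D \<rightarrow>\<^sub>E X. inj_on u D} \<times> {w \<in> ?A \<rightarrow>\<^sub>E \<omega>. inj_on w ?A} \<times> Pow ?A"
      by (auto simp: \<Phi>_def)
  qed
qed

lemma card_equivariant_injections:
  assumes "finite X" "tournament X \<omega>" "I \<subseteq> X \<times> X" "prod.swap ` I \<subseteq> I"
  shows "real (card (equivariant_injections I X)) =
    2 ^ card (I \<inter> \<omega>) * (fact (card X) / fact (card X - card (I \<inter> Id_on X))) *
      (fact (card X choose 2) / fact ((card X choose 2) - card (I \<inter> \<omega>)))"
proof -
  let ?D = "{x. (x, x) \<in> I}"
  have D: "?D \<subseteq> X"
    using assms(3) by auto
  have \<omega>: "finite \<omega>"
    using finite_subset[of \<omega> "X \<times> X"] assms(1,2) by (auto simp: tournament_def)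
  \<comment> \<open>Diagonal points are indexed by their common coordinate, so \<open>u\<close>
    ranges over injections between subsets of \<open>X\<close> itself.\<close>
  have "I \<inter> Id_on X = (\<lambda>x. (x, x)) ` ?D"
    using D by (auto simp: Id_on_def)
  then have cD: "card (I \<inter> Id_on X) = card ?D"
    by (simp add: card_image inj_on_def)
  have "card (equivariant_injections I X) = card {u \<in> ?D \<rightarrow>\<^sub>E X. inj_on u ?D} *
      (card {w \<in> I \<inter> \<omega> \<rightarrow>\<^sub>E \<omega>. inj_on w (I \<inter> \<omega>)} * 2 ^ card (I \<inter> \<omega>))"
    using bij_betw_same_card[OF bij_betw_equivariant_extension[OF assms(2-4)]] \<omega>
    by (simp add: card_cartesian_product card_Pow del: Pow_Int_eq)
  moreover have "card (I \<inter> \<omega>) \<le> card \<omega>"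
    using \<omega> by (simp add: card_mono)
  ultimately show ?thesis
    using card_injections[of ?D X] card_injections[of "I \<inter> \<omega>" \<omega>] D \<omega> assms(1)
      card_tournament[OF assms(1,2)] cD
    by (simp add: finite_subset card_mono)
qed

section \<open>Pairmorph transformations and the \<R>-classes they determine\<close>

lemma pairmorph_apply:
  "p \<in> X \<times> X \<Longrightarrow> pairmorph X f p = (f p, f (prod.swap p))"
  by (cases p) (auto simp: pairmorph_def)

lemma pairmorph_mem:
  assumes "f \<in> binops X" "p \<in> X \<times> X"
  shows "pairmorph X f p \<in> X \<times> X"
  using assms by (cases p) (auto simp: pairmorph_def binops_def)

lemma pairmorph_swap:
  "p \<in> X \<times> X \<Longrightarrow> pairmorph X f (prod.swap p) = prod.swap (pairmorph X f p)"
  by (cases p) (auto simp: pairmorph_def)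

lemma binop_mult_apply:
  "p \<in> X \<times> X \<Longrightarrow> (f \<otimes>\<^bsub>binop_monoid X\<^esub> g) p = g (pairmorph X f p)"
  by (cases p) (auto simp: binop_monoid_def pairmorph_def)

text \<open>The transformation of \<open>f \<triangleright> h\<close> is that of \<open>h\<close>
  after that of \<open>f\<close>, so it identifies whatever the latter identifies. Conversely,
  inclusion of kernels lets \<open>g\<close> factor through the transformation of
  \<open>f\<close>.\<close>

lemma right_multiple_iff:
  assumes "f \<in> binops X" "g \<in> binops X"
  shows "(\<exists>h\<in>binops X. g = f \<otimes>\<^bsub>binop_monoid X\<^esub> h) \<longleftrightarrow>
    (\<forall>p\<in>X \<times> X. \<forall>q\<in>X \<times> X. pairmorph X f p = pairmorph X f q \<longrightarrow> pairmorph X g p = pairmorph X g q)"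
    (is "?L \<longleftrightarrow> ?R")
proof
  assume ?L
  then obtain h where h: "g = f \<otimes>\<^bsub>binop_monoid X\<^esub> h" by blast
  have "pairmorph X g p = (h (pairmorph X f p), h (prod.swap (pairmorph X f p)))" if "p \<in> X \<times> X" for p
  proof -
    have "prod.swap p \<in> X \<times> X"
      using that by auto
    then show ?thesis
      using that unfolding h by (simp only: pairmorph_apply[of p X "f \<otimes>\<^bsub>binop_monoid X\<^esub> h"] binop_mult_apply pairmorph_swap)
  qed
  then show ?R by simp
next
  assume R: ?R
  \<comment> \<open>On the image, \<open>h\<close> reads \<open>g\<close> at a chosen preimage;
    elsewhere \<open>fst q\<close> serves as an arbitrary value in \<open>X\<close>.\<close>
  define h where "h = (\<lambda>q\<in>X \<times> X. if q \<in> pairmorph X f ` (X \<times> X)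
    then g (inv_into (X \<times> X) (pairmorph X f) q) else fst q)"
  have "h \<in> binops X"
    unfolding binops_def h_def
  proof (rule restrict_PiE_iff[THEN iffD2], rule ballI)
    fix q assume "q \<in> X \<times> X"
    then show "(if q \<in> pairmorph X f ` (X \<times> X)
        then g (inv_into (X \<times> X) (pairmorph X f) q) else fst q) \<in> X"
      using PiE_mem[OF assms(2)[unfolded binops_def]] inv_into_into[of q "pairmorph X f" "X \<times> X"]
      by (simp add: mem_Times_iff)
  qed
  moreover have "g p = (f \<otimes>\<^bsub>binop_monoid X\<^esub> h) p" for p
  proof (cases "p \<in> X \<times> X")
    case True
    let ?p = "inv_into (X \<times> X) (pairmorph X f) (pairmorph X f p)"
    have "?p \<in> X \<times> X" "pairmorph X f ?p = pairmorph X f p"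
      using True by (simp_all add: inv_into_into f_inv_into_f)
    \<comment> \<open>The kernel condition equates the transformations of \<open>g\<close> at
      \<open>?p\<close> and \<open>p\<close>; their first coordinates are the values of
      \<open>g\<close>.\<close>
    then have "g ?p = g p"
      using R True pairmorph_apply[of _ X g] by (metis prod.inject)
    then show ?thesis
      using True pairmorph_mem[OF assms(1) True] by (simp add: binop_mult_apply h_def)
  next
    case False
    then have "g p = undefined"
      using assms(2) by (metis PiE_arb binops_def)
    then show ?thesis
      using False by (cases p) (auto simp: binop_monoid_def)
  qed
  ultimately show ?L by blast
qed

text \<open>The unit puts each element into its own principal right ideal, and by associativity a
  right multiple generates a smaller ideal. Equality of ideals is thus mutual right
  divisibility.\<close>

lemma (in monoid) green_R_iff:
  assumes "x \<in> carrier G" "y \<in> carrier G"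
  shows "green_R G x y \<longleftrightarrow> (\<exists>z\<in>carrier G. y = x \<otimes> z) \<and> (\<exists>z\<in>carrier G. x = y \<otimes> z)"
    (is "_ \<longleftrightarrow> ?R")
proof
  assume g: "green_R G x y"
  have "x \<otimes> \<one> = x" "y \<otimes> \<one> = y"
    using assms by auto
  then have "x \<in> {x \<otimes> z |z. z \<in> carrier G}" "y \<in> {y \<otimes> z |z. z \<in> carrier G}"
    by (metis (mono_tags, lifting) mem_Collect_eq one_closed)+
  then show ?R
    using g unfolding green_R_def by blast
next
  have *: "{y \<otimes> z |z. z \<in> carrier G} \<subseteq> {x \<otimes> z |z. z \<in> carrier G}"
    if "z \<in> carrier G" "y = x \<otimes> z" "x \<in> carrier G" for x y z
    using that m_assoc by fastforce
  assume ?R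
  then show "green_R G x y"
    unfolding green_R_def using * assms by blast
qed

text \<open>Divisibility in each direction gives one inclusion of kernels.\<close>

lemma R_class_binop_monoid:
  assumes "f \<in> binops X"
  shows "R_class (binop_monoid X) f = {g \<in> binops X. \<forall>p\<in>X \<times> X. \<forall>q\<in>X \<times> X.
    pairmorph X g p = pairmorph X g q \<longleftrightarrow> pairmorph X f p = pairmorph X f q}"
proof -
  have carr: "carrier (binop_monoid X) = binops X"
    by (simp add: binop_monoid_def)
  have "green_R (binop_monoid X) f g \<longleftrightarrow> (\<forall>p\<in>X \<times> X. \<forall>q\<in>X \<times> X.
      pairmorph X g p = pairmorph X g q \<longleftrightarrow> pairmorph X f p = pairmorph X f q)"
    if g: "g \<in> binops X" for g
    using monoid.green_R_iff[OF monoid_binop_monoid, of f X g] assms g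
    unfolding carr right_multiple_iff[OF assms g] right_multiple_iff[OF g assms] by blast
  then show ?thesis
    unfolding R_class_def carr by blast
qed

text \<open>An operation is the first coordinate of its transformation, so
  \<open>e \<circ> T\<close> is encoded by \<open>fst (e (T p))\<close>; by equivariance nothing is
  lost, the second coordinate being the first one at the swapped argument.\<close>

lemma bij_betw_R_class:
  assumes f: "f \<in> binops X"
  defines "T \<equiv> pairmorph X f"
  shows "bij_betw (\<lambda>e. \<lambda>p\<in>X \<times> X. fst (e (T p)))
    (equivariant_injections (T ` (X \<times> X)) X) (R_class (binop_monoid X) f)"
proof -
  let ?I = "T ` (X \<times> X)"
  let ?F = "\<lambda>e :: 'a \<times> 'a \<Rightarrow> 'a \<times> 'a. \<lambda>p\<in>X \<times> X. fst (e (T p))"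
  have swapXX: "prod.swap p \<in> X \<times> X" if "p \<in> X \<times> X" for p :: "'a \<times> 'a"
    using that by auto
  have T_swap: "T (prod.swap p) = prod.swap (T p)" if "p \<in> X \<times> X" for p
    using that by (simp add: T_def pairmorph_swap)
  have pm_F: "pairmorph X (?F e) p = e (T p)"
    if "e \<in> equivariant_injections ?I X" "p \<in> X \<times> X" for e p
  proof -
    have "e (prod.swap (T p)) = prod.swap (e (T p))"
      using that by (auto simp: equivariant_injections_def)
    then show ?thesis
      using that(2) swapXX[OF that(2)] T_swap[OF that(2)]
      by (simp only: pairmorph_apply restrict_apply' fst_swap) simp
  qed
  show ?thesis
  proof (rule bij_betw_imageI)
    show "inj_on ?F (equivariant_injections ?I X)"
    proof (rule inj_onI)
      fix e e' assume e: "e \<in> equivariant_injections ?I X" "e' \<in> equivariant_injections ?I X" "?F e = ?F e'"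
      then have "e (T p) = e' (T p)" if "p \<in> X \<times> X" for p
        using pm_F that by metis
      moreover have "e \<in> ?I \<rightarrow>\<^sub>E X \<times> X" "e' \<in> ?I \<rightarrow>\<^sub>E X \<times> X"
        using e by (auto simp: equivariant_injections_def)
      ultimately show "e = e'"
        by (intro PiE_ext[of e ?I _ e']) auto
    qed
    show "?F ` equivariant_injections ?I X = R_class (binop_monoid X) f"
    proof (intro equalityI subsetI)
      fix g assume "g \<in> ?F ` equivariant_injections ?I X"
      then obtain e where e: "e \<in> equivariant_injections ?I X" "g = ?F e" by blast
      have eI: "inj_on e ?I" "e \<in> ?I \<rightarrow>\<^sub>E X \<times> X"
        using e(1) by (auto simp: equivariant_injections_def)
      have "fst (e (T p)) \<in> X" if "p \<in> X \<times> X" for p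
        using PiE_mem[OF eI(2), of "T p"] that by (simp add: mem_Times_iff)
      then have "g \<in> binops X"
        unfolding binops_def e(2) by (intro restrict_PiE_iff[THEN iffD2] ballI)
      moreover have "pairmorph X g p = pairmorph X g q \<longleftrightarrow> T p = T q"
        if "p \<in> X \<times> X" "q \<in> X \<times> X" for p q
        using that eI(1) pm_F[OF e(1)] unfolding e(2) by (auto dest: inj_onD)
      ultimately show "g \<in> R_class (binop_monoid X) f"
        by (simp add: R_class_binop_monoid[OF f] T_def)
    next
      fix g assume "g \<in> R_class (binop_monoid X) f"
      then have g: "g \<in> binops X"
        and ker: "\<And>p q. p \<in> X \<times> X \<Longrightarrow> q \<in> X \<times> X \<Longrightarrow>
          pairmorph X g p = pairmorph X g q \<longleftrightarrow> T p = T q"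
        by (auto simp: R_class_binop_monoid[OF f] T_def)
      \<comment> \<open>One direction of \<open>ker\<close> makes \<open>e\<close> independent of
        the chosen preimage, as \<open>e_T\<close> expresses; the other direction makes it
        injective.\<close>
      define e where "e = (\<lambda>q\<in>?I. pairmorph X g (inv_into (X \<times> X) T q))"
      have e_T: "e (T p) = pairmorph X g p" if "p \<in> X \<times> X" for p
      proof -
        have "inv_into (X \<times> X) T (T p) \<in> X \<times> X" "T (inv_into (X \<times> X) T (T p)) = T p"
          using that by (simp_all add: inv_into_into f_inv_into_f)
        then show ?thesis
          using ker that by (simp add: e_def)
      qed
      have "e \<in> ?I \<rightarrow>\<^sub>E X \<times> X"
      proof (rule PiE_I)
        fix q assume "q \<in> ?I"
        then show "e q \<in> X \<times> X"
          using e_T pairmorph_mem[OF g] by fastforce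
      qed (simp add: e_def)
      moreover have "inj_on e ?I"
        using ker e_T by (auto simp: inj_on_def)
      moreover have "e (prod.swap q) = prod.swap (e q)" if q: "q \<in> ?I" for q
      proof -
        obtain p where p: "p \<in> X \<times> X" "q = T p"
          using q by blast
        then show ?thesis
          using e_T[OF p(1)] e_T[OF swapXX[OF p(1)]] T_swap[OF p(1)] by (simp add: pairmorph_swap)
      qed
      ultimately have "e \<in> equivariant_injections ?I X"
        by (simp add: equivariant_injections_def)
      moreover have "g = ?F e"
      proof
        fix p
        show "g p = ?F e p"
        proof (cases "p \<in> X \<times> X")
          case True
          then show ?thesis
            using e_T[OF True] by (simp add: pairmorph_apply)
        next
          case False
          then show ?thesis
            using PiE_arb[of g "X \<times> X"] g by (simp add: binops_def)
        qed
      qed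
      ultimately show "g \<in> ?F ` equivariant_injections ?I X"
        by blast
    qed
  qed
qed

section \<open>Reading \<open>arank\<close> off the image, and the final count\<close>

lemma accok_image:
  assumes f: "f \<in> binops X" and \<omega>: "tournament X \<omega>"
  shows "accok X \<omega> f ` (acdom X f \<inter> \<omega>) = pairmorph X f ` (X \<times> X) \<inter> \<omega>"
proof (intro equalityI subsetI)
  let ?T = "pairmorph X f"
  have off: "?T p \<notin> Id_on X \<longleftrightarrow> fst (?T p) \<noteq> snd (?T p)" if "p \<in> X \<times> X" for p
    using pairmorph_mem[OF f that] by (cases "?T p") (auto simp: Id_on_def)
  have accok: "accok X \<omega> f p = (if ?T p \<in> \<omega> then ?T p else ?T (prod.swap p))"
    if "p \<in> acdom X f \<inter> \<omega>" for p
    using that by (cases p) (simp add: accok_def)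
  {
    fix q assume "q \<in> accok X \<omega> f ` (acdom X f \<inter> \<omega>)"
    then obtain p where p: "p \<in> acdom X f \<inter> \<omega>" "q = accok X \<omega> f p" by blast
    then have pX: "p \<in> X \<times> X" and "fst (?T p) \<noteq> snd (?T p)"
      using off by (auto simp: acdom_def)
    then have "?T (prod.swap p) \<in> \<omega> \<longleftrightarrow> ?T p \<notin> \<omega>"
      using tournament_swap_iff[OF \<omega> pairmorph_mem[OF f pX]] by (simp add: pairmorph_swap)
    moreover have "prod.swap p \<in> X \<times> X"
      using pX by auto
    ultimately show "q \<in> ?T ` (X \<times> X) \<inter> \<omega>"
      using p accok[OF p(1)] pX by auto
  next
    fix q assume "q \<in> ?T ` (X \<times> X) \<inter> \<omega>"
    then obtain p where p: "p \<in> X \<times> X" "q = ?T p" "?T p \<in> \<omega>" by blast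
    have pswap: "prod.swap p \<in> X \<times> X"
      using p(1) by auto
    have Toff: "fst (?T p) \<noteq> snd (?T p)"
      using tournament_offdiag[OF \<omega> p(3)] by blast
    \<comment> \<open>A diagonal \<open>p\<close> would have a diagonal image. Hence
      \<open>p\<close> or its swap lies in \<open>\<omega>\<close> and is a legitimate argument of
      \<open>accok\<close>.\<close>
    then have poff: "fst p \<noteq> snd p"
      using p(1) by (cases p) (auto simp: pairmorph_def)
    have dom: "p \<in> acdom X f" "prod.swap p \<in> acdom X f"
      using p(1) pswap Toff off[OF p(1)] off[OF pswap] pairmorph_swap[OF p(1), of f]
      by (simp_all add: acdom_def)
    show "q \<in> accok X \<omega> f ` (acdom X f \<inter> \<omega>)"
    proof (cases "p \<in> \<omega>")
      case True
      then show ?thesis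
        using accok[of p] dom p by force
    next
      case False
      then have "prod.swap p \<in> \<omega>"
        using tournament_swap_iff[OF \<omega> p(1) poff] by blast
      \<comment> \<open>So at \<open>prod.swap p\<close> the else branch of \<open>accok\<close>
        applies and returns \<open>?T p\<close>.\<close>
      moreover have "?T (prod.swap p) \<notin> \<omega>"
        using tournament_swap_iff[OF \<omega> pairmorph_mem[OF f p(1)] Toff] p by (simp add: pairmorph_swap)
      ultimately show ?thesis
        using accok[of "prod.swap p"] dom p by force
    qed
  }
qed

theorem proposition15:
  fixes X :: "'a set" and \<omega> :: "('a \<times> 'a) set" and f :: "'a \<times> 'a \<Rightarrow> 'a"
    and n N c a :: nat
  assumes "finite X" and "card X = n" and "N = n choose 2"
    and "tournament X \<omega>"
    and "f \<in> carrier (binop_monoid X)"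
    and "crank X f = c" and "arank X \<omega> f = a"
  shows "real (card (R_class (binop_monoid X) f)) =
           2 ^ a * (fact n / fact (n - c)) * (fact N / fact (N - a))"
proof -
  let ?I = "pairmorph X f ` (X \<times> X)"
  have f: "f \<in> binops X"
    using assms(5) by (simp add: binop_monoid_def)
  have "?I \<subseteq> X \<times> X"
    using pairmorph_mem[OF f] by blast
  moreover have "prod.swap ` ?I \<subseteq> ?I"
  proof (rule image_subsetI)
    fix q assume "q \<in> ?I"
    then obtain p where p: "p \<in> X \<times> X" "q = pairmorph X f p" by blast
    then have "prod.swap p \<in> X \<times> X" "prod.swap q = pairmorph X f (prod.swap p)"
      by (auto simp: pairmorph_swap)
    then show "prod.swap q \<in> ?I" by (simp only: imageI)
  qed
  \<comment> \<open>By \<open>accok_image\<close>, \<open>a\<close> is the number of off-diagonal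
    swap orbits in the image, each counted through its representative in
    \<open>\<omega>\<close>.\<close>
  moreover have "card (?I \<inter> Id_on X) = c" "card (?I \<inter> \<omega>) = a"
    using assms(6,7) accok_image[OF f assms(4)] by (simp_all add: crank_def arank_def)
  moreover have "card (R_class (binop_monoid X) f) = card (equivariant_injections ?I X)"
    using bij_betw_same_card[OF bij_betw_R_class[OF f]] by simp
  ultimately show ?thesis
    using card_equivariant_injections[OF assms(1,4)] assms(2,3) by simp
qed

end
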